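(* Let $\mathcal M=(E,\rho)$ be a $q$-matroid with $\dim E=n\ge1$, fix a non-degenerate symmetric bilinear form on $E$, and let $e,v\in E$ be nonzero with $\langle e\rangle\oplus\langle v\rangle^{\perp}=E$. Let $\mathcal Q_{v^\perp}$ be the set of $1$-dimensional subspaces $\langle w\rangle$ of $E$ with $\langle w\rangle\not\le\langle v\rangle^\perp$, and $\mathcal Q_{v^\perp}^{*e}=\mathcal Q_{v^\perp}-\{\langle e\rangle\}$. Then $$\chi_{\mathcal M}(x)=\begin{cases}\chi_{\mathcal M\setminus \langle v\rangle}(x)\cdot\chi_{\mathcal M/\langle e\rangle}(x)-\sum_{\langle w\rangle\in\mathcal Q_{v^\perp}^{*e}}\chi_{\mathcal M/\langle w\rangle}(x) & \text{if }\langle v\rangle\text{ is a coloop of }\mathcal M,\\[2pt] \chi_{\mathcal M\setminus\langle v\rangle}(x)-\sum_{\langle w\rangle\in\mathcal Q_{v^\perp}}\chi_{\mathcal M/\langle w\rangle}(x) & \text{otherwise.}\end{cases}$$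
   Context: A $q$-matroid is a pair $(E,\rho)$ where $E$ is a finite-dimensional vector space over the finite field $\mathbb F_q$ and $\rho$ assigns to each subspace of $E$ a nonnegative integer such that $0\le\rho(V)\le\dim V$, $V\le W\Rightarrow\rho(V)\le\rho(W)$, and $\rho(V+W)+\rho(V\cap W)\le\rho(V)+\rho(W)$. For a subspace $V$ and the fixed form, $V^\perp=\{w:\langle w,u\rangle=0\ \forall u\in V\}$. Deletion: $\mathcal M\setminus V=(V^\perp,\rho|_{\mathcal L(V^\perp)})$. Contraction: $\mathcal M/V=(E/V,\rho_{\mathcal M/V})$ with $\rho_{\mathcal M/V}(W)=\rho(\pi^{-1}(W))-\rho(V)$, where $\pi:E\to E/V$ is the canonical projection. The dual $q$-matroid is $\mathcal M^*=(E,\rho^* )$ with $\rho^*(V)=\dim V-\rho(E)+\rho(V^\perp)$; a $1$-dimensional subspace $\langle v\rangle$ is a coloop of $\mathcal M$ if $\rho^*(\langle v\rangle)=0$, equivalently $\rho(\langle v\rangle^\perp)=\rho(E)-1$. The characteristic polynomial is $\chi_{\mathcal M}(x)=\sum_{V\le E}\mu_{\mathcal L(E)}(\{0\},V)\,x^{\rho(E)-\rho(V)}$, with $\mu_{\mathcal L(E)}$ the Möbius function of the subspace lattice of the groundspace.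
   Formalization: In the coloop case the second factor is the characteristic polynomial of the restriction of M to ⟨e⟩, not of the contraction M/⟨e⟩; the printed formula fails for n=1, ρ(E)=1, where χ_M = x−1 but the printed right-hand side is 1. *)

theory Defs
  imports
    "Jordan_Normal_Form.Missing_VectorSpace"
    "HOL-Algebra.AbelCoset"
    "HOL-Computational_Algebra.Polynomial"
begin

section \<open>Subspaces, quotients and bilinear forms\<close>

definition subspace_lattice ::
    "('f, 'x) ring_scheme \<Rightarrow> ('f, 'v) module \<Rightarrow> 'v set set" where
  "subspace_lattice K E = {V. VectorSpace.subspace K V E}"

definition subdim ::
    "('f, 'x) ring_scheme \<Rightarrow> ('f, 'v) module \<Rightarrow> 'v set \<Rightarrow> nat" where
  "subdim K E V = vectorspace.dim K (E\<lparr>carrier := V\<rparr>)"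

definition line ::
    "('f, 'x) ring_scheme \<Rightarrow> ('f, 'v) module \<Rightarrow> 'v \<Rightarrow> 'v set" where
  "line K E v = LinearCombinations.module.span K E {v}"

text \<open>
  The vectors of \<open>E / V\<close> are the cosets of \<open>V\<close>.  Adding \<open>V\<close> in the scalar multiplication only
  matters for the scalar zero, where \<open>{0}\<close> has to become the coset \<open>V\<close>.  The fields \<open>mult\<close> and
  \<open>one\<close> are an artefact of the record type \<open>module\<close> and carry no meaning.
\<close>

definition quotient_space :: "('f, 'v) module \<Rightarrow> 'v set \<Rightarrow> ('f, 'v set) module" where
  "quotient_space E V =
     \<lparr>carrier = A_RCOSETS E V,
      monoid.mult = (\<lambda>_ _. V),
      one = V,
      zero = V,
      add = (\<lambda>X Y. X <+>\<^bsub>E\<^esub> Y),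
      module.smult = (\<lambda>a X. V <+>\<^bsub>E\<^esub> ((\<lambda>x. a \<odot>\<^bsub>E\<^esub> x) ` X))\<rparr>"

text \<open>By symmetry, linearity and non-degeneracy in the first argument suffice.\<close>

locale nondegenerate_symmetric_form =
  vectorspace K E
  for K :: "('f, 'x) ring_scheme" and E :: "('f, 'v) module" +
  fixes form :: "'v \<Rightarrow> 'v \<Rightarrow> 'f"
  assumes form_closed:
      "\<lbrakk>u \<in> carrier E; w \<in> carrier E\<rbrakk> \<Longrightarrow> form u w \<in> carrier K"
    and form_sym:
      "\<lbrakk>u \<in> carrier E; w \<in> carrier E\<rbrakk> \<Longrightarrow> form u w = form w u"
    and form_add:
      "\<lbrakk>u \<in> carrier E; u' \<in> carrier E; w \<in> carrier E\<rbrakk>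
        \<Longrightarrow> form (u \<oplus>\<^bsub>E\<^esub> u') w = form u w \<oplus>\<^bsub>K\<^esub> form u' w"
    and form_smult:
      "\<lbrakk>a \<in> carrier K; u \<in> carrier E; w \<in> carrier E\<rbrakk>
        \<Longrightarrow> form (a \<odot>\<^bsub>E\<^esub> u) w = a \<otimes>\<^bsub>K\<^esub> form u w"
    and form_nondegenerate:
      "\<lbrakk>u \<in> carrier E; \<And>w. w \<in> carrier E \<Longrightarrow> form u w = \<zero>\<^bsub>K\<^esub>\<rbrakk> \<Longrightarrow> u = \<zero>\<^bsub>E\<^esub>"

definition perp ::
    "('f, 'x) ring_scheme \<Rightarrow> ('f, 'v) module \<Rightarrow> ('v \<Rightarrow> 'v \<Rightarrow> 'f) \<Rightarrow> 'v set \<Rightarrow> 'v set" where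
  "perp K E form V = {w \<in> carrier E. \<forall>u\<in>V. form w u = \<zero>\<^bsub>K\<^esub>}"


section \<open>The Moebius function of a finite poset\<close>

text \<open>
  The order is that of the element type (inclusion, for subspaces).  Only the values at
  \<open>x, y \<in> L\<close> with \<open>L\<close> finite are meaningful; finiteness is tested to make the recursion terminate.
\<close>

function mobius :: "'a::order set \<Rightarrow> 'a \<Rightarrow> 'a \<Rightarrow> int" where
  "mobius L x y =
     (if x = y then 1
      else if finite L \<and> x < y then - (\<Sum>z \<in> {z \<in> L. x \<le> z \<and> z < y}. mobius L x z)
      else 0)"
  by auto
termination
proof (relation "measure (\<lambda>(L, x, y). card {z \<in> L. z < y})", goal_cases)
  case 1
  show ?case by simp
next
  case (2 L x y z)
  then have "z \<in> L" "z < y" "finite L" by auto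
  then have "{u \<in> L. u < z} \<subset> {u \<in> L. u < y}" by auto
  then have "card {u \<in> L. u < z} < card {u \<in> L. u < y}"
    using \<open>finite L\<close> by (intro psubset_card_mono) auto
  then show ?case by simp
qed

declare mobius.simps [simp del]


section \<open>q-Matroids\<close>

text \<open>
  A pair of a groundspace and a rank function; only the values of the rank function on subspaces
  of the groundspace are meaningful, so that the restriction of the rank function to a sublattice
  is the same function.
\<close>

type_synonym ('f, 'v) qmat = "('f, 'v) module \<times> ('v set \<Rightarrow> nat)"

locale q_matroid =
  vectorspace K E
  for K :: "('f, 'x) ring_scheme" and E :: "('f, 'v) module" +
  fixes \<rho> :: "'v set \<Rightarrow> nat"
  assumes finite_field: "finite (carrier K)"
    and finite_dimensional: "fin_dim"
    and rank_le_dim: "V \<in> subspace_lattice K E \<Longrightarrow> \<rho> V \<le> subdim K E V"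
    and rank_mono:
      "\<lbrakk>V \<in> subspace_lattice K E; W \<in> subspace_lattice K E; V \<subseteq> W\<rbrakk> \<Longrightarrow> \<rho> V \<le> \<rho> W"
    and rank_submodular:
      "\<lbrakk>V \<in> subspace_lattice K E; W \<in> subspace_lattice K E\<rbrakk>
        \<Longrightarrow> \<rho> (subspace_sum V W) + \<rho> (V \<inter> W) \<le> \<rho> V + \<rho> W"

text \<open>
  Restriction to a line is what the coloop case of the deletion-contraction formula needs: the
  second factor there is \<open>\<chi>\<close> of the restriction \<open>M|\<langle>e\<rangle>\<close>.  With the contraction \<open>M/\<langle>e\<rangle>\<close> in its
  place, as the formula is also found in print, it fails already for \<open>dim E = 1\<close> and
  \<open>\<rho>(E) = 1\<close>, where \<open>\<chi>\<close> is \<open>x - 1\<close> on \<open>M\<close> but \<open>1\<close> on both \<open>M \<setminus> \<langle>v\<rangle>\<close> and \<open>M/\<langle>e\<rangle>\<close>.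
\<close>

definition qm_restriction :: "('f, 'v) qmat \<Rightarrow> 'v set \<Rightarrow> ('f, 'v) qmat" where
  "qm_restriction M W = (case M of (E, \<rho>) \<Rightarrow> (E\<lparr>carrier := W\<rparr>, \<rho>))"

definition qm_deletion ::
    "('f, 'x) ring_scheme \<Rightarrow> ('v \<Rightarrow> 'v \<Rightarrow> 'f) \<Rightarrow> ('f, 'v) qmat \<Rightarrow> 'v set \<Rightarrow> ('f, 'v) qmat" where
  "qm_deletion K form M V = qm_restriction M (perp K (fst M) form V)"

text \<open>
  The set \<open>{x \<in> carrier E. V +> x \<in> W}\<close> is the preimage of \<open>W\<close> under the canonical projection.
  It contains \<open>V\<close>, so the subtraction does not truncate.
\<close>

definition qm_contraction :: "('f, 'v) qmat \<Rightarrow> 'v set \<Rightarrow> ('f, 'v set) qmat" where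
  "qm_contraction M V =
     (case M of (E, \<rho>) \<Rightarrow>
        (quotient_space E V,
         \<lambda>W. \<rho> {x \<in> carrier E. V +>\<^bsub>E\<^esub> x \<in> W} - \<rho> V))"

text \<open>
  \<open>\<rho>*(V) = dim V - \<rho>(E) + \<rho>(V\<^sup>\<bottom>)\<close>, reordered because subtraction on \<open>nat\<close> truncates.  In a
  q-matroid \<open>\<rho>(E) \<le> dim V + \<rho>(V\<^sup>\<bottom>)\<close>, so no truncation occurs in the form below.
\<close>

definition qm_dual ::
    "('f, 'x) ring_scheme \<Rightarrow> ('v \<Rightarrow> 'v \<Rightarrow> 'f) \<Rightarrow> ('f, 'v) qmat \<Rightarrow> ('f, 'v) qmat" where
  "qm_dual K form M =
     (case M of (E, \<rho>) \<Rightarrow>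
        (E, \<lambda>V. (subdim K E V + \<rho> (perp K E form V)) - \<rho> (carrier E)))"

definition qm_coloop ::
    "('f, 'x) ring_scheme \<Rightarrow> ('v \<Rightarrow> 'v \<Rightarrow> 'f) \<Rightarrow> ('f, 'v) qmat \<Rightarrow> 'v set \<Rightarrow> bool" where
  "qm_coloop K form M V \<longleftrightarrow>
     V \<in> subspace_lattice K (fst M) \<and> subdim K (fst M) V = 1 \<and> snd (qm_dual K form M) V = 0"

definition qm_charpoly :: "('f, 'x) ring_scheme \<Rightarrow> ('f, 'v) qmat \<Rightarrow> int poly" where
  "qm_charpoly K M =
     (case M of (E, \<rho>) \<Rightarrow>
        \<Sum>V \<in> subspace_lattice K E.
          monom (mobius (subspace_lattice K E) {\<zero>\<^bsub>E\<^esub>} V) (\<rho> (carrier E) - \<rho> V))"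

definition lines_off ::
    "('f, 'x) ring_scheme \<Rightarrow> ('f, 'v) module \<Rightarrow> 'v set \<Rightarrow> 'v set set" where
  "lines_off K E H = {L \<in> subspace_lattice K E. subdim K E L = 1 \<and> \<not> L \<subseteq> H}"

end

theory Submission
  imports Defs
begin

text \<open>
  Let \<open>H = \<langle>v\<rangle>\<^sup>\<bottom>\<close>, a hyperplane.  For a subspace \<open>V\<close> not contained in \<open>H\<close>, Weisner's theorem, applied to
  the coatom \<open>V \<inter> H\<close> of the interval \<open>[0, V]\<close>, expresses \<open>\<mu>(0, V)\<close> as \<open>- \<Sum> \<mu>(L, V)\<close> over the lines \<open>L \<le> V\<close>
  outside \<open>H\<close>.  Summing over \<open>V\<close> gives
  \<open>\<chi>(M) = x ^ (\<rho>(E) - \<rho>(H)) * \<chi>(M \<setminus> \<langle>v\<rangle>) - \<Sum> \<chi>(M / L)\<close> with \<open>L\<close> ranging over all lines outside \<open>H\<close>.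
  The exponent is \<open>1\<close> or \<open>0\<close> according to whether \<open>\<langle>v\<rangle>\<close> is a coloop.  If it is, then \<open>\<rho>\<close> is additive along
  \<open>E = \<langle>e\<rangle> \<oplus> H\<close>, so that \<open>M / \<langle>e\<rangle>\<close> and \<open>M \<setminus> \<langle>v\<rangle>\<close> have the same characteristic polynomial, while that
  of \<open>M|\<langle>e\<rangle>\<close> is \<open>x - 1\<close>; this absorbs the summand \<open>L = \<langle>e\<rangle>\<close>.
\<close>

section \<open>The Moebius function\<close>

lemma mobius_outside: "\<not> x \<le> y \<Longrightarrow> mobius L x y = 0"
  by (subst mobius.simps) auto

text \<open>The recursion with its top term moved to the other side. The condition
  \<open>x \<le> z\<close> is dropped because the added values vanish, so the sum runs over a full
  order ideal and incomparable \<open>x\<close> and \<open>y\<close> are covered.\<close>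

lemma mobius_sum:
  assumes "finite L" "x \<in> L" "y \<in> L"
  shows "(\<Sum>z \<in> {z \<in> L. z \<le> y}. mobius L x z) = of_bool (x = y)"
proof (cases "x \<le> y")
  case False
  then have "mobius L x z = 0" if "z \<le> y" for z
    using that by (intro mobius_outside) (meson order_trans)
  with False show ?thesis
    by auto
next
  case True
  have "(\<Sum>z \<in> {z \<in> L. z \<le> y}. mobius L x z) = (\<Sum>z \<in> {z \<in> L. x \<le> z \<and> z \<le> y}. mobius L x z)"
    using assms by (intro sum.mono_neutral_right ballI mobius_outside) auto
  also have "{z \<in> L. x \<le> z \<and> z \<le> y} = insert y {z \<in> L. x \<le> z \<and> z < y}"
    using True assms by auto
  also have "(\<Sum>z \<in> insert y {z \<in> L. x \<le> z \<and> z < y}. mobius L x z)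
      = mobius L x y + (\<Sum>z \<in> {z \<in> L. x \<le> z \<and> z < y}. mobius L x z)"
    using assms by (subst sum.insert) auto
  also have "\<dots> = of_bool (x = y)"
  proof (cases "x = y")
    case True
    then have empty: "{z \<in> L. x \<le> z \<and> z < y} = {}"
      by auto
    show ?thesis
      unfolding empty using True by (subst mobius.simps) simp
  next
    case False
    with \<open>x \<le> y\<close> assms show ?thesis
      by (subst mobius.simps) auto
  qed
  finally show ?thesis .
qed

text \<open>The recursion never leaves the interval from \<open>x\<close> to \<open>y\<close>. This
  transfers values between the full subspace lattice and its parts below or above a fixed
  subspace.\<close>

lemma mobius_cong:
  assumes "finite L" "finite L'"
    and "\<And>z. x \<le> z \<Longrightarrow> z \<le> y \<Longrightarrow> z \<in> L \<longleftrightarrow> z \<in> L'"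
  shows "mobius L x y = mobius L' x y"
  using assms(3)
proof (induction "card {z \<in> L. z < y}" arbitrary: y rule: less_induct)
  case less
  have "mobius L x z = mobius L' x z" if "z \<in> L" "x \<le> z" "z < y" for z
  proof (rule less.hyps)
    have "{u \<in> L. u < z} \<subset> {u \<in> L. u < y}"
      using that by auto
    then show "card {u \<in> L. u < z} < card {u \<in> L. u < y}"
      using assms(1) by (intro psubset_card_mono) auto
    show "u \<in> L \<longleftrightarrow> u \<in> L'" if "x \<le> u" "u \<le> z" for u
      using that \<open>z < y\<close> by (intro less.prems) auto
  qed
  moreover have "{z \<in> L. x \<le> z \<and> z < y} = {z \<in> L'. x \<le> z \<and> z < y}"
    using less.prems by auto
  ultimately have "(\<Sum>z \<in> {z \<in> L. x \<le> z \<and> z < y}. mobius L x z)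
      = (\<Sum>z \<in> {z \<in> L'. x \<le> z \<and> z < y}. mobius L' x z)"
    by (intro sum.cong) auto
  with assms show ?case
    by (simp add: mobius.simps[of _ x y])
qed

text \<open>An order embedding is injective by antisymmetry and carries each interval of
  \<open>L\<close> onto the corresponding interval of the image, so both recursions agree term by
  term. Applied later to the projection onto a quotient and to adding a complement.\<close>

lemma mobius_image:
  fixes f :: "'a::order \<Rightarrow> 'b::order"
  assumes "finite L" "\<And>x y. x \<in> L \<Longrightarrow> y \<in> L \<Longrightarrow> f x \<le> f y \<longleftrightarrow> x \<le> y" "x \<in> L" "y \<in> L"
  shows "mobius (f ` L) (f x) (f y) = mobius L x y"
  using assms(4)
proof (induction "card {z \<in> L. z < y}" arbitrary: y rule: less_induct)
  case less
  have inj: "inj_on f L"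
    using assms(2) by (intro inj_onI antisym) (metis order_refl)+
  have mono: "f u < f w \<longleftrightarrow> u < w" if "u \<in> L" "w \<in> L" for u w
    using assms(2) that by (auto simp: less_le_not_le)
  have IH: "mobius (f ` L) (f x) (f z) = mobius L x z" if "z \<in> L" "z < y" for z
  proof (rule less.hyps)
    have "{u \<in> L. u < z} \<subset> {u \<in> L. u < y}"
      using that by auto
    then show "card {u \<in> L. u < z} < card {u \<in> L. u < y}"
      using assms(1) by (intro psubset_card_mono) auto
  qed (rule that)
  have "{z \<in> f ` L. f x \<le> z \<and> z < f y} = f ` {z \<in> L. x \<le> z \<and> z < y}"
    using assms(2,3) mono less.prems by auto
  then have "(\<Sum>z \<in> {z \<in> f ` L. f x \<le> z \<and> z < f y}. mobius (f ` L) (f x) z)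
      = (\<Sum>z \<in> {z \<in> L. x \<le> z \<and> z < y}. mobius L x z)"
    using IH inj by (simp add: sum.reindex inj_on_subset)
  with assms(1,3) less.prems show ?case
    by (simp add: mobius.simps[of _ "f x"] mobius.simps[of _ x] mono inj_on_eq_iff[OF inj])
qed

text \<open>
  A dual form of Weisner's theorem.  Summing the difference of the two sides over an order ideal
  and using \<open>mobius_sum\<close> leaves only the indicators of \<open>inf x h = b\<close>, which cancel.
\<close>

lemma mobius_cocrosscut:
  fixes L :: "'a::semilattice_inf set"
  assumes "finite L" "b \<in> L" "\<And>x. x \<in> L \<Longrightarrow> b \<le> x" "h \<in> L"
    and inf: "\<And>x y. x \<in> L \<Longrightarrow> y \<in> L \<Longrightarrow> inf x y \<in> L"
    and "x \<in> L" "\<not> x \<le> h"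
  shows "mobius L b x = - (\<Sum>a \<in> {a \<in> L. inf a h = b \<and> \<not> a \<le> h}. mobius L a x)"
proof -
  define A where "A = {a \<in> L. inf a h = b \<and> \<not> a \<le> h}"
  define g where "g z = mobius L b z + (\<Sum>a\<in>A. mobius L a z)" for z
  have "finite A" "A \<subseteq> L"
    using \<open>finite L\<close> by (auto simp: A_def)
  have "g x = 0"
    using assms(6,7)
  proof (induction "card {z \<in> L. z < x}" arbitrary: x rule: less_induct)
    case less
    have IH: "g z = 0" if "z \<in> L" "z < x" "\<not> z \<le> h" for z
    proof (rule less.hyps)
      have "{u \<in> L. u < z} \<subset> {u \<in> L. u < x}"
        using that by auto
      then show "card {u \<in> L. u < z} < card {u \<in> L. u < x}"
        using assms(1) by (intro psubset_card_mono) auto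
    qed (use that in auto)
    have "x \<noteq> b"
      using less.prems assms by auto
    have "(\<Sum>z \<in> {z \<in> L. z \<le> x}. g z)
        = (\<Sum>z \<in> {z \<in> L. z \<le> x}. mobius L b z) + (\<Sum>a\<in>A. \<Sum>z \<in> {z \<in> L. z \<le> x}. mobius L a z)"
      unfolding g_def sum.distrib by (subst sum.swap) simp
    also have "\<dots> = (\<Sum>a\<in>A. of_bool (a = x))"
      using \<open>x \<noteq> b\<close> assms(1,2) less.prems \<open>A \<subseteq> L\<close> by (simp add: mobius_sum subset_iff)
    \<comment> \<open>Since \<open>x\<close> is not below \<open>h\<close>, it belongs to
      \<open>A\<close> exactly if \<open>inf x h = b\<close>.\<close>
    also have "\<dots> = of_bool (inf x h = b)"
      using \<open>finite A\<close> less.prems by (auto simp: A_def of_bool_def)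
    finally have total: "(\<Sum>z \<in> {z \<in> L. z \<le> x}. g z) = of_bool (inf x h = b)" .
    \<comment> \<open>No \<open>a\<close> in \<open>A\<close> lies below such a \<open>z\<close>,
      since otherwise \<open>a \<le> h\<close>.\<close>
    have "g z = mobius L b z" if "z \<le> h" for z
      using that unfolding g_def A_def by (auto intro!: sum.neutral mobius_outside)
    then have "(\<Sum>z \<in> {z \<in> L. z \<le> inf x h}. g z) = (\<Sum>z \<in> {z \<in> L. z \<le> inf x h}. mobius L b z)"
      by (intro sum.cong) auto
    also have "\<dots> = of_bool (inf x h = b)"
      using assms less.prems by (subst mobius_sum) auto
    finally have below: "(\<Sum>z \<in> {z \<in> L. z \<le> inf x h}. g z) = of_bool (inf x h = b)" .
    have "{z \<in> L. z \<le> x} = {z \<in> L. z \<le> inf x h} \<union> {z \<in> L. z \<le> x \<and> \<not> z \<le> h}"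
      by auto
    then have "(\<Sum>z \<in> {z \<in> L. z \<le> x}. g z)
        = (\<Sum>z \<in> {z \<in> L. z \<le> inf x h}. g z) + (\<Sum>z \<in> {z \<in> L. z \<le> x \<and> \<not> z \<le> h}. g z)"
      using assms(1) by (auto intro!: sum.union_disjoint)
    with total below have "(\<Sum>z \<in> {z \<in> L. z \<le> x \<and> \<not> z \<le> h}. g z) = 0"
      by simp
    \<comment> \<open>By the induction hypothesis every term with \<open>z < x\<close> vanishes, so
      only \<open>g x\<close> remains.\<close>
    also have "(\<Sum>z \<in> {z \<in> L. z \<le> x \<and> \<not> z \<le> h}. g z) = (\<Sum>z \<in> {x}. g z)"
      using assms(1) less.prems by (intro sum.mono_neutral_right ballI IH) (auto simp: less_le)
    finally show ?case
      by simp
  qed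
  then show ?thesis
    unfolding g_def A_def by simp
qed


section \<open>Subspaces and lines\<close>

text \<open>\<open>subspace_lattice\<close> and \<open>quotient_space\<close> require the plain \<open>module\<close> record, not an extension of it.\<close>

locale plain_vectorspace =
  vectorspace K E
  for K :: "('f, 'x) ring_scheme" and E :: "('f, 'v) module"
begin

lemma subspace_lattice_iff:
  "V \<in> subspace_lattice K E \<longleftrightarrow>
    V \<subseteq> carrier E \<and> \<zero>\<^bsub>E\<^esub> \<in> V \<and> (\<forall>u\<in>V. \<forall>w\<in>V. u \<oplus>\<^bsub>E\<^esub> w \<in> V) \<and>
    (\<forall>a\<in>carrier K. \<forall>u\<in>V. a \<odot>\<^bsub>E\<^esub> u \<in> V)"
  using vectorspace_axioms module_axioms
  by (auto simp: subspace_lattice_def VectorSpace.subspace_def submodule_def)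

lemma subspace_latticeI:
  assumes "V \<subseteq> carrier E" "\<zero>\<^bsub>E\<^esub> \<in> V"
    and "\<And>u w. u \<in> V \<Longrightarrow> w \<in> V \<Longrightarrow> u \<oplus>\<^bsub>E\<^esub> w \<in> V"
    and "\<And>a u. a \<in> carrier K \<Longrightarrow> u \<in> V \<Longrightarrow> a \<odot>\<^bsub>E\<^esub> u \<in> V"
  shows "V \<in> subspace_lattice K E"
  using assms by (simp add: subspace_lattice_iff)

lemma subspace_lattice_submodule: "V \<in> subspace_lattice K E \<Longrightarrow> submodule K V E"
  by (simp add: subspace_lattice_def)

lemma
  assumes "V \<in> subspace_lattice K E"
  shows subspace_carrier: "u \<in> V \<Longrightarrow> u \<in> carrier E"
    and subspace_subset: "V \<subseteq> carrier E"
    and subspace_zero: "\<zero>\<^bsub>E\<^esub> \<in> V"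
    and subspace_add: "u \<in> V \<Longrightarrow> w \<in> V \<Longrightarrow> u \<oplus>\<^bsub>E\<^esub> w \<in> V"
    and subspace_smult: "a \<in> carrier K \<Longrightarrow> u \<in> V \<Longrightarrow> a \<odot>\<^bsub>E\<^esub> u \<in> V"
  using assms by (auto simp: subspace_lattice_iff)

lemma subspace_minus:
  assumes "V \<in> subspace_lattice K E" "u \<in> V"
  shows "\<ominus>\<^bsub>E\<^esub> u \<in> V"
  using subspace_smult[OF assms(1) _ assms(2), of "\<ominus>\<^bsub>K\<^esub> \<one>\<^bsub>K\<^esub>"] subspace_carrier[OF assms]
  by (simp add: smult_minus_1)

lemma subspace_diff:
  assumes "V \<in> subspace_lattice K E" "u \<in> V" "w \<in> V"
  shows "u \<ominus>\<^bsub>E\<^esub> w \<in> V"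
  using assms unfolding a_minus_def by (intro subspace_add subspace_minus)

lemma add_diff_cancel:
  assumes "u \<in> carrier E" "w \<in> carrier E"
  shows "(u \<oplus>\<^bsub>E\<^esub> w) \<ominus>\<^bsub>E\<^esub> u = w"
  using assms by (simp add: M.minus_eq M.add.m_comm[of u w] M.a_assoc M.r_neg)

section \<open>Lattice operations on subspaces and the modular law\<close>

lemma carrier_in_lattice: "carrier E \<in> subspace_lattice K E"
  by (intro subspace_latticeI) auto

lemma zero_in_lattice: "{\<zero>\<^bsub>E\<^esub>} \<in> subspace_lattice K E"
  by (intro subspace_latticeI) auto

lemma Int_in_lattice:
  "V \<in> subspace_lattice K E \<Longrightarrow> W \<in> subspace_lattice K E \<Longrightarrow> V \<inter> W \<in> subspace_lattice K E"
  by (auto simp: subspace_lattice_iff)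

lemma sum_in_lattice:
  "V \<in> subspace_lattice K E \<Longrightarrow> W \<in> subspace_lattice K E \<Longrightarrow>
    subspace_sum V W \<in> subspace_lattice K E"
  unfolding subspace_lattice_def by (auto intro: sum_is_subspace)

lemma subspace_sum_iff: "x \<in> subspace_sum V W \<longleftrightarrow> (\<exists>u\<in>V. \<exists>w\<in>W. x = u \<oplus>\<^bsub>E\<^esub> w)"
  by (auto simp: submodule_sum_def)

lemma
  assumes "V \<in> subspace_lattice K E" "W \<in> subspace_lattice K E"
  shows sum_upper1: "V \<subseteq> subspace_sum V W" and sum_upper2: "W \<subseteq> subspace_sum V W"
proof -
  show "V \<subseteq> subspace_sum V W"
    using assms by (intro in_sum subspace_lattice_submodule)
  show "W \<subseteq> subspace_sum V W"
    using in_sum[of W V] msum_comm[of V W] assms subspace_lattice_submodule by simp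
qed

lemma sum_least:
  assumes "U \<in> subspace_lattice K E" "V \<subseteq> U" "W \<subseteq> U"
  shows "subspace_sum V W \<subseteq> U"
  using assms subspace_add by (fastforce simp: subspace_sum_iff)

text \<open>Dedekind's modular law: if \<open>u \<oplus> w\<close> lies in \<open>U\<close> and
  \<open>u\<close> in \<open>V \<subseteq> U\<close>, then \<open>w\<close>, being a difference of
  two elements of \<open>U\<close>, lies in \<open>U\<close> as well.\<close>

lemma sum_Int_modular:
  assumes "U \<in> subspace_lattice K E" "V \<in> subspace_lattice K E" "W \<in> subspace_lattice K E"
    and "V \<subseteq> U"
  shows "subspace_sum V W \<inter> U = subspace_sum V (W \<inter> U)"
proof
  show "subspace_sum V W \<inter> U \<subseteq> subspace_sum V (W \<inter> U)"
  proof
    fix x assume "x \<in> subspace_sum V W \<inter> U"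
    then obtain u w where uw: "u \<in> V" "w \<in> W" "x = u \<oplus>\<^bsub>E\<^esub> w" "x \<in> U"
      by (auto simp: subspace_sum_iff)
    have "u \<in> carrier E" "w \<in> carrier E"
      using uw assms subspace_carrier by blast+
    then have "w = x \<ominus>\<^bsub>E\<^esub> u"
      using uw(3) by (simp add: add_diff_cancel)
    also have "\<dots> \<in> U"
      using uw assms by (intro subspace_diff) auto
    finally show "x \<in> subspace_sum V (W \<inter> U)"
      using uw by (auto simp: subspace_sum_iff)
  qed
  show "subspace_sum V (W \<inter> U) \<subseteq> subspace_sum V W \<inter> U"
    using assms subspace_add by (fastforce simp: subspace_sum_iff)
qed

section \<open>Lines, one-dimensional subspaces and finiteness\<close>

lemma line_eq:
  assumes "v \<in> carrier E"
  shows "line K E v = {a \<odot>\<^bsub>E\<^esub> v |a. a \<in> carrier K}"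
proof -
  have "line K E v = {lincomb a {v} |a. a \<in> {v} \<rightarrow> carrier K}"
    using assms by (simp add: line_def finite_span)
  also have "\<dots> = {a \<odot>\<^bsub>E\<^esub> v |a. a \<in> carrier K}"
  proof -
    have "lincomb a {v} = a v \<odot>\<^bsub>E\<^esub> v" if "a v \<in> carrier K" for a
      using that assms by (simp add: lincomb_def)
    moreover have "\<exists>b. a = b v \<and> b v \<in> carrier K" if "a \<in> carrier K" for a
      using that by (intro exI[of _ "\<lambda>_. a"]) simp
    ultimately show ?thesis
      by (force simp: Pi_iff)
  qed
  finally show ?thesis .
qed

lemma line_in_lattice: "v \<in> carrier E \<Longrightarrow> line K E v \<in> subspace_lattice K E"
  unfolding line_def subspace_lattice_def by (simp add: span_is_subspace)

lemma in_line: "v \<in> carrier E \<Longrightarrow> v \<in> line K E v"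
  using in_own_span[of "{v}"] by (simp add: line_def)

lemma line_subset:
  assumes "V \<in> subspace_lattice K E" "v \<in> V"
  shows "line K E v \<subseteq> V"
  unfolding line_def using assms by (intro span_is_subset subspace_lattice_submodule) auto

lemma subspace_vectorspace:
  "V \<in> subspace_lattice K E \<Longrightarrow> vectorspace K (E\<lparr>carrier := V\<rparr>)"
  by (simp add: subspace_lattice_def subspace_is_vs)

lemma subdim_line:
  assumes "v \<in> carrier E" "v \<noteq> \<zero>\<^bsub>E\<^esub>"
  shows "subdim K E (line K E v) = 1"
proof -
  interpret L: vectorspace K "E\<lparr>carrier := line K E v\<rparr>"
    using assms by (intro subspace_vectorspace line_in_lattice)
  show ?thesis
    unfolding subdim_def
  proof (rule L.dim1I)
    show "L.gen_set {v}"
      using assms in_line subspace_lattice_submodule[OF line_in_lattice]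
      by (simp add: span_li_not_depend line_def)
  qed (use assms in_line in auto)
qed

text \<open>A nonzero vector forms a linearly independent set whose size equals the dimension, hence
  a basis. Finiteness of \<open>V\<close> yields finite dimension, as \<open>V\<close> generates
  itself.\<close>

lemma subdim_eq_1D:
  assumes "V \<in> subspace_lattice K E" "finite V" "subdim K E V = 1" "w \<in> V" "w \<noteq> \<zero>\<^bsub>E\<^esub>"
  shows "V = line K E w"
proof -
  interpret V: vectorspace K "E\<lparr>carrier := V\<rparr>"
    using assms by (intro subspace_vectorspace)
  have "V.span V = V"
    using V.in_own_span[of V] V.span_is_subset2[of V] by auto
  then have "V.fin_dim"
    unfolding V.fin_dim_def using \<open>finite V\<close> by auto
  moreover have "V.lin_indpt {w}"
    using V.lin_dep_iff_in_span[of "{}" w] V.finite_lin_indpt2[of "{}"] V.span_empty assms by auto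
  ultimately have "V.basis {w}"
    using assms by (intro V.dim_li_is_basis) (auto simp: subdim_def)
  then have "V.span {w} = V"
    by (simp add: V.basis_def)
  then show ?thesis
    using assms subspace_lattice_submodule by (simp add: line_def span_li_not_depend)
qed

lemma finite_carrier:
  assumes "finite (carrier K)" "fin_dim"
  shows "finite (carrier E)"
proof -
  obtain A where A: "finite A" "A \<subseteq> carrier E" "span A = carrier E"
    using assms(2) by (auto simp: fin_dim_def)
  \<comment> \<open>Restricting coefficient functions to \<open>A\<close> makes them range over an
    extensional function space, which is finite.\<close>
  have "span A \<subseteq> (\<lambda>a. lincomb a A) ` (A \<rightarrow>\<^sub>E carrier K)"
  proof
    fix x assume "x \<in> span A"
    then obtain a where a: "a \<in> A \<rightarrow> carrier K" "x = lincomb a A"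
      unfolding finite_span[OF A(1,2)] by blast
    moreover have "lincomb (restrict a A) A = lincomb a A"
      using A a by (intro lincomb_cong) auto
    ultimately show "x \<in> (\<lambda>a. lincomb a A) ` (A \<rightarrow>\<^sub>E carrier K)"
      by (intro image_eqI[of _ _ "restrict a A"]) auto
  qed
  moreover have "finite (A \<rightarrow>\<^sub>E carrier K)"
    using A assms by (intro finite_PiE) auto
  ultimately show ?thesis
    using A finite_subset by (metis finite_imageI)
qed

end


section \<open>Quotients and minors\<close>

context plain_vectorspace
begin

lemma subspace_abelian_subgroup:
  assumes "N \<in> subspace_lattice K E"
  shows "abelian_subgroup N E"
proof (rule abelian_subgroupI3)
  have "subgroup N (add_monoid E)"
    using assms subspace_minus[OF assms]
    by (intro M.add.subgroupI) (auto simp: subspace_lattice_iff a_inv_def)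
  then show "additive_subgroup N E"
    by (rule additive_subgroupI)
qed (rule M.abelian_group_axioms)

lemma coset_eq_iff:
  assumes "N \<in> subspace_lattice K E" "x \<in> carrier E" "y \<in> carrier E"
  shows "N +>\<^bsub>E\<^esub> x = N +>\<^bsub>E\<^esub> y \<longleftrightarrow> x \<ominus>\<^bsub>E\<^esub> y \<in> N"
proof -
  interpret N: abelian_subgroup N E
    using assms by (intro subspace_abelian_subgroup)
  have "N +>\<^bsub>E\<^esub> x = N +>\<^bsub>E\<^esub> y \<longleftrightarrow> x \<in> N +>\<^bsub>E\<^esub> y"
    using assms N.a_repr_independence'[of x y] N.a_rcos_self[of x] by auto
  also have "\<dots> \<longleftrightarrow> x \<ominus>\<^bsub>E\<^esub> y \<in> N"
    using assms by (simp add: N.a_rcos_module M.minus_eq)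
  finally show ?thesis .
qed

lemma quotient_carrier: "carrier (quotient_space E N) = (\<lambda>x. N +>\<^bsub>E\<^esub> x) ` carrier E"
  by (auto simp: quotient_space_def A_RCOSETS_def')

lemma quotient_zero:
  assumes "N \<in> subspace_lattice K E"
  shows "\<zero>\<^bsub>quotient_space E N\<^esub> = N +>\<^bsub>E\<^esub> \<zero>\<^bsub>E\<^esub>"
  using assms subspace_subset by (simp add: quotient_space_def)

lemma quotient_add:
  assumes "N \<in> subspace_lattice K E" "x \<in> carrier E" "y \<in> carrier E"
  shows "(N +>\<^bsub>E\<^esub> x) \<oplus>\<^bsub>quotient_space E N\<^esub> (N +>\<^bsub>E\<^esub> y) = N +>\<^bsub>E\<^esub> (x \<oplus>\<^bsub>E\<^esub> y)"
  using abelian_subgroup.a_rcos_sum[OF subspace_abelian_subgroup] assms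
  by (simp add: quotient_space_def)

text \<open>The identity \<open>n + a(m + x) = (n + am) + ax\<close> absorbs both elements of
  \<open>N\<close> into one. It needs no inverse of \<open>a\<close>, so the zero scalar is no
  special case.\<close>

lemma quotient_smult:
  assumes N: "N \<in> subspace_lattice K E" and a: "a \<in> carrier K" and x: "x \<in> carrier E"
  shows "a \<odot>\<^bsub>quotient_space E N\<^esub> (N +>\<^bsub>E\<^esub> x) = N +>\<^bsub>E\<^esub> (a \<odot>\<^bsub>E\<^esub> x)"
proof -
  have "N <+>\<^bsub>E\<^esub> (\<lambda>y. a \<odot>\<^bsub>E\<^esub> y) ` (N +>\<^bsub>E\<^esub> x) = N +>\<^bsub>E\<^esub> (a \<odot>\<^bsub>E\<^esub> x)"
  proof
    show "N <+>\<^bsub>E\<^esub> (\<lambda>y. a \<odot>\<^bsub>E\<^esub> y) ` (N +>\<^bsub>E\<^esub> x) \<subseteq> N +>\<^bsub>E\<^esub> (a \<odot>\<^bsub>E\<^esub> x)"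
    proof
      fix z assume "z \<in> N <+>\<^bsub>E\<^esub> (\<lambda>y. a \<odot>\<^bsub>E\<^esub> y) ` (N +>\<^bsub>E\<^esub> x)"
      then obtain n m where nm: "n \<in> N" "m \<in> N" "z = n \<oplus>\<^bsub>E\<^esub> a \<odot>\<^bsub>E\<^esub> (m \<oplus>\<^bsub>E\<^esub> x)"
        by (auto simp: set_add_def' a_r_coset_def')
      have "n \<in> carrier E" "m \<in> carrier E"
        using nm N subspace_carrier by blast+
      then have "z = (n \<oplus>\<^bsub>E\<^esub> a \<odot>\<^bsub>E\<^esub> m) \<oplus>\<^bsub>E\<^esub> a \<odot>\<^bsub>E\<^esub> x"
        using nm a x by (simp add: smult_r_distr M.a_assoc)
      moreover have "n \<oplus>\<^bsub>E\<^esub> a \<odot>\<^bsub>E\<^esub> m \<in> N"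
        using nm N a by (intro subspace_add subspace_smult)
      ultimately show "z \<in> N +>\<^bsub>E\<^esub> (a \<odot>\<^bsub>E\<^esub> x)"
        by (auto simp: a_r_coset_def')
    qed
    \<comment> \<open>Here the representative \<open>x\<close> itself suffices as the element of its
      coset.\<close>
    show "N +>\<^bsub>E\<^esub> (a \<odot>\<^bsub>E\<^esub> x) \<subseteq> N <+>\<^bsub>E\<^esub> (\<lambda>y. a \<odot>\<^bsub>E\<^esub> y) ` (N +>\<^bsub>E\<^esub> x)"
    proof -
      have "x \<in> N +>\<^bsub>E\<^esub> x"
        using N x abelian_subgroup.a_rcos_self[OF subspace_abelian_subgroup] by blast
      then show ?thesis
        by (auto simp: set_add_def' a_r_coset_def'[of _ _ "a \<odot>\<^bsub>E\<^esub> x"])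
    qed
  qed
  then show ?thesis
    by (simp add: quotient_space_def)
qed

lemma quotient_vectorspace:
  assumes N: "N \<in> subspace_lattice K E"
  shows "vectorspace K (quotient_space E N)"
proof (rule vs_criteria, goal_cases)
  case 1
  show ?case
    by (rule field_axioms)
next
  case 4
  show ?case
  proof
    fix X assume "X \<in> carrier (quotient_space E N)"
    then obtain x where x: "x \<in> carrier E" "X = N +>\<^bsub>E\<^esub> x"
      by (auto simp: quotient_carrier)
    then show "\<exists>Y\<in>carrier (quotient_space E N). X \<oplus>\<^bsub>quotient_space E N\<^esub> Y = \<zero>\<^bsub>quotient_space E N\<^esub>"
      using N by (intro bexI[of _ "N +>\<^bsub>E\<^esub> (\<ominus>\<^bsub>E\<^esub> x)"])
        (auto simp: quotient_carrier quotient_add quotient_zero M.r_neg)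
  qed
next
  case 6
  show ?case
    using N by (auto simp: quotient_carrier quotient_add M.a_comm)
qed (use N in \<open>auto simp: quotient_carrier quotient_zero quotient_add quotient_smult M.a_assoc
  smult_assoc1 smult_l_distr smult_r_distr\<close>)

lemma coset_vimage_image:
  assumes "N \<in> subspace_lattice K E" "V \<in> subspace_lattice K E" "N \<subseteq> V"
  shows "{x \<in> carrier E. N +>\<^bsub>E\<^esub> x \<in> (\<lambda>x. N +>\<^bsub>E\<^esub> x) ` V} = V"
proof (intro equalityI subsetI)
  fix x assume "x \<in> {x \<in> carrier E. N +>\<^bsub>E\<^esub> x \<in> (\<lambda>x. N +>\<^bsub>E\<^esub> x) ` V}"
  then obtain y where y: "x \<in> carrier E" "y \<in> V" "N +>\<^bsub>E\<^esub> x = N +>\<^bsub>E\<^esub> y"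
    by auto
  have "y \<in> carrier E"
    using y assms subspace_carrier by blast
  then have "x \<ominus>\<^bsub>E\<^esub> y \<in> V"
    using y assms coset_eq_iff by auto
  then have "y \<oplus>\<^bsub>E\<^esub> (x \<ominus>\<^bsub>E\<^esub> y) \<in> V"
    using y assms by (intro subspace_add)
  then show "x \<in> V"
    using y \<open>y \<in> carrier E\<close> by (simp add: M.minus_eq M.a_comm[of x] M.r_neg2)
qed (use assms subspace_carrier in auto)

text \<open>The correspondence theorem: the preimage of a subspace of the quotient is a subspace
  above \<open>N\<close> that projects onto it. Together with \<open>coset_vimage_image\<close> this
  makes the projection a bijection on the subspaces above \<open>N\<close>.\<close>

lemma quotient_subspace_lattice:
  assumes N: "N \<in> subspace_lattice K E"
  shows "subspace_lattice K (quotient_space E N) =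
    (\<lambda>V. (\<lambda>x. N +>\<^bsub>E\<^esub> x) ` V) ` {V \<in> subspace_lattice K E. N \<subseteq> V}"
proof -
  interpret Q: plain_vectorspace K "quotient_space E N"
    by (intro plain_vectorspace.intro quotient_vectorspace N)
  show ?thesis
  proof (intro equalityI subsetI)
    fix W assume W: "W \<in> subspace_lattice K (quotient_space E N)"
    define V where "V = {x \<in> carrier E. N +>\<^bsub>E\<^esub> x \<in> W}"
    have "V \<in> subspace_lattice K E"
    proof (rule subspace_latticeI)
      show "\<zero>\<^bsub>E\<^esub> \<in> V"
        using Q.subspace_zero[OF W] N by (simp add: V_def quotient_zero)
      show "u \<oplus>\<^bsub>E\<^esub> w \<in> V" if "u \<in> V" "w \<in> V" for u w
        using Q.subspace_add[OF W, of "N +>\<^bsub>E\<^esub> u" "N +>\<^bsub>E\<^esub> w"] that N by (simp add: V_def quotient_add)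
      show "a \<odot>\<^bsub>E\<^esub> u \<in> V" if "a \<in> carrier K" "u \<in> V" for a u
        using Q.subspace_smult[OF W, of a "N +>\<^bsub>E\<^esub> u"] that N by (simp add: V_def quotient_smult)
    qed (auto simp: V_def)
    moreover have "N \<subseteq> V"
    proof
      fix x assume "x \<in> N"
      then have "N +>\<^bsub>E\<^esub> x = \<zero>\<^bsub>quotient_space E N\<^esub>"
        using abelian_subgroup.a_rcos_const[OF subspace_abelian_subgroup[OF N]]
        by (simp add: quotient_space_def)
      then show "x \<in> V"
        using Q.subspace_zero[OF W] \<open>x \<in> N\<close> N subspace_carrier by (auto simp: V_def)
    qed
    moreover have "W = (\<lambda>x. N +>\<^bsub>E\<^esub> x) ` V"
      using Q.subspace_subset[OF W] by (auto simp: V_def quotient_carrier)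
    ultimately show "W \<in> (\<lambda>V. (\<lambda>x. N +>\<^bsub>E\<^esub> x) ` V) ` {V \<in> subspace_lattice K E. N \<subseteq> V}"
      by blast
  next
    fix W assume "W \<in> (\<lambda>V. (\<lambda>x. N +>\<^bsub>E\<^esub> x) ` V) ` {V \<in> subspace_lattice K E. N \<subseteq> V}"
    then obtain V where V: "V \<in> subspace_lattice K E" "W = (\<lambda>x. N +>\<^bsub>E\<^esub> x) ` V"
      by auto
    note carr = subspace_carrier[OF V(1)]
    show "W \<in> subspace_lattice K (quotient_space E N)"
    proof (rule Q.subspace_latticeI)
      show "W \<subseteq> carrier (quotient_space E N)"
        using V carr by (auto simp: quotient_carrier)
      show "\<zero>\<^bsub>quotient_space E N\<^esub> \<in> W"
        using V subspace_zero N by (auto simp: quotient_zero)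
      show "X \<oplus>\<^bsub>quotient_space E N\<^esub> Y \<in> W" if "X \<in> W" "Y \<in> W" for X Y
        using that V N carr subspace_add[OF V(1)] by (auto simp: quotient_add)
      show "a \<odot>\<^bsub>quotient_space E N\<^esub> X \<in> W" if "a \<in> carrier K" "X \<in> W" for a X
        using that V N carr subspace_smult[OF V(1)] by (auto simp: quotient_smult)
    qed
  qed
qed

lemma restriction_subspace_lattice:
  assumes "W \<in> subspace_lattice K E"
  shows "subspace_lattice K (E\<lparr>carrier := W\<rparr>) = {V \<in> subspace_lattice K E. V \<subseteq> W}"
proof -
  interpret W: plain_vectorspace K "E\<lparr>carrier := W\<rparr>"
    by (intro plain_vectorspace.intro subspace_vectorspace assms)
  show ?thesis
    using subspace_subset[OF assms] 
    by (simp add: set_eq_iff subspace_lattice_iff W.subspace_lattice_iff) blast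
qed

end

sublocale q_matroid \<subseteq> plain_vectorspace ..

sublocale nondegenerate_symmetric_form \<subseteq> plain_vectorspace ..

section \<open>Characteristic polynomials of minors as sums over the full subspace lattice\<close>

context q_matroid
begin

lemma finite_subspace_lattice: "finite (subspace_lattice K E)"
proof (rule finite_subset)
  show "subspace_lattice K E \<subseteq> Pow (carrier E)"
    using subspace_subset by auto
  show "finite (Pow (carrier E))"
    using finite_carrier finite_field finite_dimensional by simp
qed

lemma charpoly_restriction:
  assumes "W \<in> subspace_lattice K E"
  shows "qm_charpoly K (qm_restriction (E, \<rho>) W) =
    (\<Sum>V \<in> {V \<in> subspace_lattice K E. V \<subseteq> W}.
      monom (mobius (subspace_lattice K E) {\<zero>\<^bsub>E\<^esub>} V) (\<rho> W - \<rho> V))"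
proof -
  have "mobius {V \<in> subspace_lattice K E. V \<subseteq> W} {\<zero>\<^bsub>E\<^esub>} V = mobius (subspace_lattice K E) {\<zero>\<^bsub>E\<^esub>} V"
    if "V \<subseteq> W" for V
    using that finite_subspace_lattice by (intro mobius_cong) auto
  then show ?thesis
    using assms by (simp add: qm_charpoly_def qm_restriction_def restriction_subspace_lattice)
qed

text \<open>The projection is an order isomorphism from the subspaces above \<open>N\<close> onto
  the lattice of the quotient, which transports the Moebius values. The two copies of
  \<open>\<rho> N\<close> in the exponent cancel.\<close>

lemma charpoly_contraction:
  assumes N: "N \<in> subspace_lattice K E"
  shows "qm_charpoly K (qm_contraction (E, \<rho>) N) =
    (\<Sum>V \<in> {V \<in> subspace_lattice K E. N \<subseteq> V}.
      monom (mobius (subspace_lattice K E) N V) (\<rho> (carrier E) - \<rho> V))"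
proof -
  define U where "U = {V \<in> subspace_lattice K E. N \<subseteq> V}"
  define q where "q = (\<lambda>V. (\<lambda>x. N +>\<^bsub>E\<^esub> x) ` V)"
  define p where "p = (\<lambda>W. {x \<in> carrier E. N +>\<^bsub>E\<^esub> x \<in> W})"
  have pq: "p (q V) = V" if "V \<in> U" for V
    using that coset_vimage_image N unfolding U_def p_def q_def by blast
  have q_mono: "q V \<subseteq> q W \<longleftrightarrow> V \<subseteq> W" if "V \<in> U" "W \<in> U" for V W
  proof
    assume "q V \<subseteq> q W"
    then have "p (q V) \<subseteq> p (q W)"
      by (auto simp: p_def)
    with that show "V \<subseteq> W"
      by (simp add: pq)
  qed (auto simp: q_def)
  have inj: "inj_on q U"
    by (metis pq inj_onI)
  have "N +>\<^bsub>E\<^esub> x = N" if "x \<in> N" for x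
    using abelian_subgroup.a_rcos_const[OF subspace_abelian_subgroup[OF N] that] .
  then have "q N = {N}"
    using subspace_zero[OF N] by (auto simp: q_def)
  have "N \<in> U" "carrier E \<in> U"
    using N carrier_in_lattice subspace_subset by (auto simp: U_def)
  have "finite U"
    using finite_subspace_lattice by (simp add: U_def)
  have mobius: "mobius (q ` U) {N} (q V) = mobius (subspace_lattice K E) N V" if "V \<in> U" for V
  proof -
    have "mobius (q ` U) (q N) (q V) = mobius U N V"
      using \<open>finite U\<close> q_mono \<open>N \<in> U\<close> that by (intro mobius_image)
    also have "\<dots> = mobius (subspace_lattice K E) N V"
      using finite_subspace_lattice \<open>finite U\<close> by (intro mobius_cong) (auto simp: U_def)
    finally show ?thesis
      by (simp add: \<open>q N = {N}\<close>)
  qed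
  \<comment> \<open>The cancellation takes place in the natural numbers and therefore needs these
    inequalities.\<close>
  have rank: "\<rho> N \<le> \<rho> V" if "V \<in> U" for V
    using that N by (intro rank_mono) (auto simp: U_def)
  have "qm_charpoly K (qm_contraction (E, \<rho>) N)
      = (\<Sum>W \<in> q ` U. monom (mobius (q ` U) {N} W)
          (\<rho> (p (carrier (quotient_space E N))) - \<rho> N - (\<rho> (p W) - \<rho> N)))"
    unfolding qm_charpoly_def qm_contraction_def U_def q_def p_def
    \<comment> \<open>\<open>quotient_space\<close> stays folded until its lattice has been
      rewritten; unfolding it afterwards identifies its zero with \<open>N\<close>.\<close>
    by (simp add: quotient_subspace_lattice[OF N]) (simp add: quotient_space_def)
  also have "\<dots> = (\<Sum>V \<in> U. monom (mobius (q ` U) {N} (q V))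
      (\<rho> (p (q (carrier E))) - \<rho> N - (\<rho> (p (q V)) - \<rho> N)))"
    using inj by (simp add: sum.reindex q_def quotient_carrier)
  also have "\<dots> = (\<Sum>V \<in> U. monom (mobius (subspace_lattice K E) N V) (\<rho> (carrier E) - \<rho> V))"
    using \<open>carrier E \<in> U\<close> by (intro sum.cong) (auto simp: mobius pq rank)
  finally show ?thesis
    by (simp add: U_def)
qed

end


section \<open>Deletion and contraction\<close>

text \<open>A nonzero vector of \<open>V\<close> is a nonzero multiple of \<open>e\<close>, and
  dividing by the scalar puts \<open>e\<close> into \<open>V\<close>.\<close>

lemma (in plain_vectorspace) line_subspace_cases:
  assumes "e \<in> carrier E" "V \<in> subspace_lattice K E" "V \<subseteq> line K E e"
  shows "V = {\<zero>\<^bsub>E\<^esub>} \<or> V = line K E e"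
proof (cases "V \<subseteq> {\<zero>\<^bsub>E\<^esub>}")
  case True
  then show ?thesis
    using subspace_zero[OF assms(2)] by auto
next
  case False
  then obtain w where w: "w \<in> V" "w \<noteq> \<zero>\<^bsub>E\<^esub>"
    by auto
  then obtain a where a: "a \<in> carrier K" "w = a \<odot>\<^bsub>E\<^esub> e"
    using assms by (auto simp: line_eq)
  then have "a \<noteq> \<zero>\<^bsub>K\<^esub>"
    using w assms(1) by auto
  then have "e = inv\<^bsub>K\<^esub> a \<odot>\<^bsub>E\<^esub> w" "inv\<^bsub>K\<^esub> a \<in> carrier K"
    using a assms(1) mult_inverse[of a e w] field_Units by auto
  then have "e \<in> V"
    using w assms(2) subspace_smult by auto
  then show ?thesis
    using assms line_subset by auto
qed

section \<open>The orthogonal space of a line and the lines outside it\<close>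

context nondegenerate_symmetric_form
begin

lemma perp_line:
  assumes "v \<in> carrier E"
  shows "perp K E form (line K E v) = {w \<in> carrier E. form w v = \<zero>\<^bsub>K\<^esub>}"
proof -
  \<comment> \<open>Linearity is available in the first argument; symmetry moves it to the
    second.\<close>
  have "form w (a \<odot>\<^bsub>E\<^esub> v) = a \<otimes>\<^bsub>K\<^esub> form w v" if "w \<in> carrier E" "a \<in> carrier K" for w a
    using that assms form_smult[of a v w] form_sym[of w] by simp
  then show ?thesis
    using assms in_line[OF assms] by (auto simp: perp_def line_eq)
qed

lemma perp_line_in_lattice:
  assumes "v \<in> carrier E"
  shows "perp K E form (line K E v) \<in> subspace_lattice K E"
proof -
  have "form \<zero>\<^bsub>E\<^esub> v = \<zero>\<^bsub>K\<^esub>"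
    using form_smult[of "\<zero>\<^bsub>K\<^esub>" "\<zero>\<^bsub>E\<^esub>" v] form_closed[of "\<zero>\<^bsub>E\<^esub>" v] assms by simp
  then show ?thesis
    using assms by (intro subspace_latticeI) (auto simp: perp_line form_add form_smult)
qed

text \<open>Replaces the dimension condition by the lattice condition that
  \<open>mobius_cocrosscut\<close> asks for. As \<open>H\<close> is the kernel of the functional
  \<open>form _ v\<close>, a subspace meeting \<open>H\<close> trivially embeds into the field,
  hence is at most a line.\<close>

lemma lines_off_perp_line:
  assumes v: "v \<in> carrier E" and "finite (carrier E)"
  defines "H \<equiv> perp K E form (line K E v)"
  shows "lines_off K E H = {L \<in> subspace_lattice K E. L \<inter> H = {\<zero>\<^bsub>E\<^esub>} \<and> \<not> L \<subseteq> H}"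
proof -
  note H = perp_line_in_lattice[OF v, folded H_def]
  have "subdim K E L = 1 \<longleftrightarrow> L \<inter> H = {\<zero>\<^bsub>E\<^esub>}" if L: "L \<in> subspace_lattice K E" "\<not> L \<subseteq> H" for L
  proof -
    obtain w where w: "w \<in> L" "w \<notin> H"
      using L by auto
    then have "w \<in> carrier E" "w \<noteq> \<zero>\<^bsub>E\<^esub>"
      using L H subspace_carrier subspace_zero by auto
    show ?thesis
    proof
      assume "subdim K E L = 1"
      then have "L = line K E w"
        using L w \<open>w \<noteq> \<zero>\<^bsub>E\<^esub>\<close> finite_subset[OF subspace_subset \<open>finite (carrier E)\<close>]
        by (intro subdim_eq_1D) auto
      \<comment> \<open>A line has only two subspaces, so the intersection has to be the zero
        space.\<close>
      moreover have "L \<inter> H \<noteq> L"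
        using L by auto
      ultimately show "L \<inter> H = {\<zero>\<^bsub>E\<^esub>}"
        using line_subspace_cases[of w "L \<inter> H"] \<open>w \<in> carrier E\<close> L H Int_in_lattice by auto
    next
      assume LH: "L \<inter> H = {\<zero>\<^bsub>E\<^esub>}"
      have nz: "form w v \<noteq> \<zero>\<^bsub>K\<^esub>" and cw: "form w v \<in> carrier K"
        using w v \<open>w \<in> carrier E\<close> form_closed by (auto simp: H_def perp_line)
      have "L \<subseteq> line K E w"
      proof
        fix x assume "x \<in> L"
        then have x: "x \<in> carrier E"
          using L subspace_carrier by auto
        \<comment> \<open>The scalar is chosen so that the functional vanishes on
          \<open>x - a w\<close>.\<close>
        define a where "a = form x v \<otimes>\<^bsub>K\<^esub> inv\<^bsub>K\<^esub> (form w v)"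
        have a: "a \<in> carrier K" "a \<otimes>\<^bsub>K\<^esub> form w v = form x v"
          using nz cw x v form_closed field_Units by (auto simp: a_def R.m_assoc)
        define y where "y = x \<oplus>\<^bsub>E\<^esub> (\<ominus>\<^bsub>K\<^esub> a) \<odot>\<^bsub>E\<^esub> w"
        have "form y v = form x v \<oplus>\<^bsub>K\<^esub> (\<ominus>\<^bsub>K\<^esub> a) \<otimes>\<^bsub>K\<^esub> form w v"
          unfolding y_def using x v a \<open>w \<in> carrier E\<close> by (simp add: form_add form_smult)
        also have "\<dots> = \<zero>\<^bsub>K\<^esub>"
          using a cw x v form_closed by (simp add: R.l_minus R.r_neg)
        finally have "y \<in> H"
          using x v a \<open>w \<in> carrier E\<close> by (simp add: H_def perp_line y_def)
        moreover have "y \<in> L"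
          unfolding y_def using \<open>x \<in> L\<close> w a L by (intro subspace_add subspace_smult) auto
        ultimately have "y = \<zero>\<^bsub>E\<^esub>"
          using LH by auto
        then have "x = a \<odot>\<^bsub>E\<^esub> w"
          unfolding y_def using x a \<open>w \<in> carrier E\<close>
          by (metis M.add.inv_closed M.minus_equality M.minus_minus smult_closed smult_l_minus)
        then show "x \<in> line K E w"
          using a \<open>w \<in> carrier E\<close> by (auto simp: line_eq)
      qed
      then have "L = line K E w"
        using line_subset L w by blast
      then show "subdim K E L = 1"
        using \<open>w \<in> carrier E\<close> \<open>w \<noteq> \<zero>\<^bsub>E\<^esub>\<close> subdim_line by simp
    qed
  qed
  then show ?thesis
    by (auto simp: lines_off_def)
qed

end

section \<open>The crosscut expansion and contraction by a complement\<close>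

context q_matroid
begin

text \<open>The sum is split at \<open>H\<close>, and \<open>mobius_cocrosscut\<close> with
  \<open>h = H\<close> rewrites the part outside. The first sum keeps
  \<open>\<rho> (carrier E)\<close> in its exponents, so it need not yet be the polynomial of the
  restriction to \<open>H\<close>.\<close>

lemma charpoly_crosscut:
  assumes H: "H \<in> subspace_lattice K E"
  shows "qm_charpoly K (E, \<rho>) =
    (\<Sum>V \<in> {V \<in> subspace_lattice K E. V \<subseteq> H}.
      monom (mobius (subspace_lattice K E) {\<zero>\<^bsub>E\<^esub>} V) (\<rho> (carrier E) - \<rho> V)) -
    (\<Sum>L \<in> {L \<in> subspace_lattice K E. L \<inter> H = {\<zero>\<^bsub>E\<^esub>} \<and> \<not> L \<subseteq> H}.
      qm_charpoly K (qm_contraction (E, \<rho>) L))"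
proof -
  let ?S = "subspace_lattice K E"
  define A where "A = {L \<in> ?S. L \<inter> H = {\<zero>\<^bsub>E\<^esub>} \<and> \<not> L \<subseteq> H}"
  define t where "t L V = monom (mobius ?S L V) (\<rho> (carrier E) - \<rho> V)" for L V
  note fin = finite_subspace_lattice
  have t: "t {\<zero>\<^bsub>E\<^esub>} V = - (\<Sum>L\<in>A. t L V)" if "V \<in> ?S" "\<not> V \<subseteq> H" for V
  proof -
    have "mobius ?S {\<zero>\<^bsub>E\<^esub>} V = - (\<Sum>L\<in>A. mobius ?S L V)"
      unfolding A_def using that fin H zero_in_lattice subspace_zero Int_in_lattice
      by (intro mobius_cocrosscut) auto
    then show ?thesis
      by (simp add: t_def monom_sum minus_monom[symmetric])
  qed
  have "(\<Sum>V \<in> {V \<in> ?S. \<not> V \<subseteq> H}. t {\<zero>\<^bsub>E\<^esub>} V) = - (\<Sum>V \<in> {V \<in> ?S. \<not> V \<subseteq> H}. \<Sum>L\<in>A. t L V)"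
    by (simp add: t sum_negf)
  also have "(\<Sum>V \<in> {V \<in> ?S. \<not> V \<subseteq> H}. \<Sum>L\<in>A. t L V) = (\<Sum>L\<in>A. \<Sum>V \<in> {V \<in> ?S. \<not> V \<subseteq> H}. t L V)"
    by (rule sum.swap)
  also have "\<dots> = (\<Sum>L\<in>A. \<Sum>V \<in> {V \<in> ?S. L \<subseteq> V}. t L V)"
  proof (rule sum.cong[OF refl])
    fix L assume "L \<in> A"
    \<comment> \<open>Every \<open>V\<close> above \<open>L\<close> lies outside \<open>H\<close>
      because \<open>L\<close> does; for all other \<open>V\<close> the Moebius value is
      zero.\<close>
    then show "(\<Sum>V \<in> {V \<in> ?S. \<not> V \<subseteq> H}. t L V) = (\<Sum>V \<in> {V \<in> ?S. L \<subseteq> V}. t L V)"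
      using fin by (intro sum.mono_neutral_right) (auto simp: A_def t_def mobius_outside)
  qed
  also have "\<dots> = (\<Sum>L\<in>A. qm_charpoly K (qm_contraction (E, \<rho>) L))"
    by (intro sum.cong) (auto simp: A_def t_def charpoly_contraction)
  finally have off: "(\<Sum>V \<in> {V \<in> ?S. \<not> V \<subseteq> H}. t {\<zero>\<^bsub>E\<^esub>} V)
      = - (\<Sum>L\<in>A. qm_charpoly K (qm_contraction (E, \<rho>) L))" .
  have "qm_charpoly K (E, \<rho>) = (\<Sum>V \<in> {V \<in> ?S. V \<subseteq> H} \<union> {V \<in> ?S. \<not> V \<subseteq> H}. t {\<zero>\<^bsub>E\<^esub>} V)"
    unfolding qm_charpoly_def t_def by (auto intro!: sum.cong)
  also have "\<dots> = (\<Sum>V \<in> {V \<in> ?S. V \<subseteq> H}. t {\<zero>\<^bsub>E\<^esub>} V) + (\<Sum>V \<in> {V \<in> ?S. \<not> V \<subseteq> H}. t {\<zero>\<^bsub>E\<^esub>} V)"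
    using fin by (intro sum.union_disjoint) auto
  finally show ?thesis
    unfolding off by (simp add: A_def t_def)
qed

text \<open>Adding \<open>N\<close> maps the interval below \<open>H\<close> isomorphically onto the
  interval above \<open>N\<close>, with inverse \<open>V \<mapsto> V \<inter> H\<close>; the modular
  law gives both compositions. The rank hypothesis makes \<open>\<rho>\<close> grow by exactly
  \<open>\<rho> N\<close> along this map, so the exponents agree.\<close>

lemma charpoly_contraction_complement:
  assumes N: "N \<in> subspace_lattice K E" and H: "H \<in> subspace_lattice K E"
    and sum: "subspace_sum N H = carrier E" and Int: "N \<inter> H = {\<zero>\<^bsub>E\<^esub>}"
    and rank: "\<rho> N + \<rho> H = \<rho> (carrier E)"
  shows "qm_charpoly K (qm_contraction (E, \<rho>) N) = qm_charpoly K (qm_restriction (E, \<rho>) H)"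
proof -
  let ?S = "subspace_lattice K E"
  define D where "D = {U \<in> ?S. U \<subseteq> H}"
  define f where "f U = subspace_sum U N" for U
  have fS: "f U \<in> ?S" "N \<subseteq> f U" "U \<subseteq> f U" if "U \<in> D" for U
    using that N sum_in_lattice sum_upper1 sum_upper2 by (simp_all add: f_def D_def)
  have fH: "f U \<inter> H = U" if "U \<in> D" for U
  proof -
    have "f U \<inter> H = subspace_sum U (N \<inter> H)"
      unfolding f_def using that N H by (intro sum_Int_modular) (auto simp: D_def)
    also have "\<dots> = U"
      using that subspace_carrier by (force simp: Int subspace_sum_iff D_def)
    finally show ?thesis .
  qed
  have inv: "V \<inter> H \<in> D" "f (V \<inter> H) = V" if V: "V \<in> ?S" "N \<subseteq> V" for V
  proof -
    show "V \<inter> H \<in> D"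
      using that H Int_in_lattice by (auto simp: D_def)
    have "f (V \<inter> H) = subspace_sum N (H \<inter> V)"
      using N V H Int_in_lattice msum_comm subspace_lattice_submodule
      by (simp add: f_def Int_commute)
    also have "\<dots> = subspace_sum N H \<inter> V"
      using N V H by (intro sum_Int_modular[symmetric])
    also have "\<dots> = V"
      using subspace_subset[OF V(1)] by (auto simp: sum)
    finally show "f (V \<inter> H) = V" .
  qed
  have inj: "inj_on f D"
    by (metis fH inj_onI)
  have image: "{V \<in> ?S. N \<subseteq> V} = f ` D"
  proof (intro equalityI subsetI)
    fix V assume "V \<in> {V \<in> ?S. N \<subseteq> V}"
    then show "V \<in> f ` D"
      using inv by (metis (mono_tags, lifting) imageI mem_Collect_eq)
  qed (use fS in auto)
  have f_mono: "f U \<subseteq> f W \<longleftrightarrow> U \<subseteq> W" if "U \<in> D" "W \<in> D" for U W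
  proof
    assume "f U \<subseteq> f W"
    then have "f U \<inter> H \<subseteq> f W \<inter> H"
      by auto
    with that show "U \<subseteq> W"
      by (simp add: fH)
  qed (unfold f_def subset_iff subspace_sum_iff, blast)
  have zero: "{\<zero>\<^bsub>E\<^esub>} \<in> D"
    using zero_in_lattice subspace_zero[OF H] by (simp add: D_def)
  have f_zero: "f {\<zero>\<^bsub>E\<^esub>} = N"
    using subspace_carrier[OF N] by (force simp: f_def subspace_sum_iff)
  have mobius: "mobius ?S N (f U) = mobius ?S {\<zero>\<^bsub>E\<^esub>} U" if "U \<in> D" for U
  proof -
    have "mobius ?S N (f U) = mobius (f ` D) (f {\<zero>\<^bsub>E\<^esub>}) (f U)"
      unfolding f_zero image[symmetric] using finite_subspace_lattice by (intro mobius_cong) auto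
    also have "\<dots> = mobius D {\<zero>\<^bsub>E\<^esub>} U"
      using finite_subspace_lattice that zero f_mono by (intro mobius_image) (auto simp: D_def)
    also have "\<dots> = mobius ?S {\<zero>\<^bsub>E\<^esub>} U"
      using finite_subspace_lattice that by (intro mobius_cong) (auto simp: D_def)
    finally show ?thesis .
  qed
  have f_rank: "\<rho> (f U) = \<rho> U + \<rho> N" if U: "U \<in> D" for U
  proof (rule antisym)
    have US: "U \<in> ?S"
      using U by (simp add: D_def)
    show "\<rho> (f U) \<le> \<rho> U + \<rho> N"
      using rank_submodular[OF US N] by (simp add: f_def)
    \<comment> \<open>Submodularity for \<open>f U\<close> and \<open>H\<close>, with sum
      \<open>E\<close> and intersection \<open>U\<close>, gives
      \<open>\<rho> E + \<rho> U \<le> \<rho> (f U) + \<rho> H\<close>; the rank hypothesis then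
      cancels \<open>\<rho> H\<close>.\<close>
    have "carrier E \<subseteq> subspace_sum (f U) H"
      unfolding sum[symmetric] using fS[OF U] H sum_upper1 sum_upper2
      by (intro sum_least sum_in_lattice) blast+
    then have "subspace_sum (f U) H = carrier E"
      using fS[OF U] H sum_in_lattice subspace_subset by blast
    then show "\<rho> U + \<rho> N \<le> \<rho> (f U)"
      using rank_submodular[OF fS(1)[OF U] H] rank by (simp add: fH[OF U])
  qed
  have "qm_charpoly K (qm_contraction (E, \<rho>) N)
      = (\<Sum>U\<in>D. monom (mobius ?S N (f U)) (\<rho> (carrier E) - \<rho> (f U)))"
    using inj by (simp add: charpoly_contraction N image sum.reindex)
  also have "\<dots> = (\<Sum>U\<in>D. monom (mobius ?S {\<zero>\<^bsub>E\<^esub>} U) (\<rho> H - \<rho> U))"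
    by (intro sum.cong) (auto simp: mobius f_rank rank[symmetric])
  finally show ?thesis
    by (simp add: charpoly_restriction H D_def)
qed

lemma rank_zero: "\<rho> {\<zero>\<^bsub>E\<^esub>} = 0"
proof -
  interpret Z: vectorspace K "E\<lparr>carrier := {\<zero>\<^bsub>E\<^esub>}\<rparr>"
    by (intro subspace_vectorspace zero_in_lattice)
  have "Z.dim = 0"
    using Z.in_own_span[of "{\<zero>\<^bsub>E\<^esub>}"] Z.span_is_subset2[of "{\<zero>\<^bsub>E\<^esub>}"] by (intro Z.dim0I) auto
  then show ?thesis
    using rank_le_dim[OF zero_in_lattice] by (simp add: subdim_def)
qed

text \<open>The lattice of a line has two elements, with Moebius values \<open>1\<close> and
  \<open>-1\<close>. Keeping the exponent general includes lines of rank zero.\<close>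

lemma charpoly_restriction_line:
  assumes e: "e \<in> carrier E" "e \<noteq> \<zero>\<^bsub>E\<^esub>"
  shows "qm_charpoly K (qm_restriction (E, \<rho>) (line K E e)) = monom 1 (\<rho> (line K E e)) - 1"
proof -
  let ?S = "subspace_lattice K E"
  note line = line_in_lattice[OF e(1)]
  have below: "{V \<in> ?S. V \<subseteq> line K E e} = {{\<zero>\<^bsub>E\<^esub>}, line K E e}"
    using line_subspace_cases[OF e(1)] line zero_in_lattice subspace_zero by auto
  have ne: "{\<zero>\<^bsub>E\<^esub>} \<noteq> line K E e"
    using in_line e by auto
  have "mobius ?S {\<zero>\<^bsub>E\<^esub>} {\<zero>\<^bsub>E\<^esub>} = 1"
    by (subst mobius.simps) simp
  moreover have "mobius ?S {\<zero>\<^bsub>E\<^esub>} {\<zero>\<^bsub>E\<^esub>} + mobius ?S {\<zero>\<^bsub>E\<^esub>} (line K E e) = 0"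
    using mobius_sum[OF finite_subspace_lattice zero_in_lattice line] ne by (simp add: below)
  ultimately have "mobius ?S {\<zero>\<^bsub>E\<^esub>} (line K E e) = - 1"
    by simp
  then show ?thesis
    using ne line \<open>mobius ?S {\<zero>\<^bsub>E\<^esub>} {\<zero>\<^bsub>E\<^esub>} = 1\<close>
    by (simp add: charpoly_restriction below rank_zero minus_monom[symmetric])
qed

end

theorem theorem5p14:
  fixes K :: "('f, 'x) ring_scheme"
    and E :: "('f, 'v) module"
    and \<rho> :: "'v set \<Rightarrow> nat"
    and form :: "'v \<Rightarrow> 'v \<Rightarrow> 'f"
    and e v :: 'v
    and n :: nat
  defines "M \<equiv> (E, \<rho>)"
    and "H \<equiv> perp K E form (line K E v)"
  assumes "q_matroid K E \<rho>"
    and "vectorspace.dim K E = n" and "n \<ge> 1"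
    and "nondegenerate_symmetric_form K E form"
    and "e \<in> carrier E" and "e \<noteq> \<zero>\<^bsub>E\<^esub>"
    and "v \<in> carrier E" and "v \<noteq> \<zero>\<^bsub>E\<^esub>"
    and "LinearCombinations.module.submodule_sum E (line K E e) H = carrier E"
    and "line K E e \<inter> H = {\<zero>\<^bsub>E\<^esub>}"
  shows "qm_charpoly K M =
    (if qm_coloop K form M (line K E v)
     then qm_charpoly K (qm_deletion K form M (line K E v))
            * qm_charpoly K (qm_restriction M (line K E e))
          - (\<Sum>L \<in> lines_off K E H - {line K E e}. qm_charpoly K (qm_contraction M L))
     else qm_charpoly K (qm_deletion K form M (line K E v))
          - (\<Sum>L \<in> lines_off K E H. qm_charpoly K (qm_contraction M L)))"
proof -
  interpret q_matroid K E \<rho> by fact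
  interpret nondegenerate_symmetric_form K E form by fact
  let ?S = "subspace_lattice K E" and ?N = "line K E e"
  have H: "H \<in> ?S" and N: "?N \<in> ?S"
    using perp_line_in_lattice line_in_lattice \<open>v \<in> carrier E\<close> \<open>e \<in> carrier E\<close> by (simp_all add: H_def)
  have off: "lines_off K E H = {L \<in> ?S. L \<inter> H = {\<zero>\<^bsub>E\<^esub>} \<and> \<not> L \<subseteq> H}"
    unfolding H_def using \<open>v \<in> carrier E\<close> finite_carrier finite_field finite_dimensional
    by (intro lines_off_perp_line)
  define D where "D = qm_charpoly K (qm_restriction M H)"
  have deletion: "qm_charpoly K (qm_deletion K form M (line K E v)) = D"
    by (simp add: D_def qm_deletion_def M_def H_def)
  \<comment> \<open>The dual rank of the line is \<open>1 + \<rho> H - \<rho> E\<close> in natural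
    numbers, which is zero exactly if \<open>\<rho> H < \<rho> E\<close>.\<close>
  have coloop: "qm_coloop K form M (line K E v) \<longleftrightarrow> \<rho> H < \<rho> (carrier E)"
    using subdim_line[of v] line_in_lattice[of v] \<open>v \<in> carrier E\<close> \<open>v \<noteq> \<zero>\<^bsub>E\<^esub>\<close>
    by (auto simp: qm_coloop_def qm_dual_def M_def H_def)
  have "\<rho> ?N \<le> 1"
    using rank_le_dim[OF N] subdim_line \<open>e \<in> carrier E\<close> \<open>e \<noteq> \<zero>\<^bsub>E\<^esub>\<close> by simp
  have "\<rho> (carrier E) \<le> \<rho> ?N + \<rho> H"
    using rank_submodular[OF N H] assms(11) by simp
  have "\<rho> H \<le> \<rho> (carrier E)"
    using H carrier_in_lattice subspace_subset rank_mono by simp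
  have D: "D = (\<Sum>V \<in> {V \<in> ?S. V \<subseteq> H}. monom (mobius ?S {\<zero>\<^bsub>E\<^esub>} V) (\<rho> H - \<rho> V))"
    using charpoly_restriction[OF H] by (simp add: D_def M_def)
  note crosscut = charpoly_crosscut[OF H, folded M_def off]
  show ?thesis
  proof (cases "\<rho> H < \<rho> (carrier E)")
    case False
    then have "\<rho> (carrier E) = \<rho> H"
      using \<open>\<rho> H \<le> \<rho> (carrier E)\<close> by simp
    with False show ?thesis
      by (simp add: crosscut coloop deletion D)
  next
    case True
    \<comment> \<open>From \<open>\<rho> H < \<rho> E \<le> \<rho> ?N + \<rho> H \<le> 1 + \<rho>
      H\<close> all ranks are forced.\<close>
    then have rank: "\<rho> ?N = 1" "\<rho> (carrier E) = Suc (\<rho> H)"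
      using \<open>\<rho> ?N \<le> 1\<close> \<open>\<rho> (carrier E) \<le> \<rho> ?N + \<rho> H\<close> by auto
    \<comment> \<open>Each exponent exceeds the one in \<open>D\<close> by one, which produces the
      factor \<open>x\<close>.\<close>
    have "\<rho> (carrier E) - \<rho> V = Suc (\<rho> H - \<rho> V)" if "V \<in> ?S" "V \<subseteq> H" for V
      using that rank rank_mono[of V H] H by simp
    then have "(\<Sum>V \<in> {V \<in> ?S. V \<subseteq> H}. monom (mobius ?S {\<zero>\<^bsub>E\<^esub>} V) (\<rho> (carrier E) - \<rho> V))
        = D * monom 1 1"
      unfolding D sum_distrib_right by (intro sum.cong) (auto simp: mult_monom)
    moreover have "?N \<in> lines_off K E H" "finite (lines_off K E H)"
      using N assms(12) in_line[OF \<open>e \<in> carrier E\<close>] \<open>e \<noteq> \<zero>\<^bsub>E\<^esub>\<close> finite_subspace_lattice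
      by (auto simp: off)
    moreover have "qm_charpoly K (qm_contraction M ?N) = D"
      unfolding M_def D_def using N H assms(11,12) rank
      by (intro charpoly_contraction_complement) auto
    \<comment> \<open>The summand of \<open>?N\<close> equals \<open>D\<close>, and
      \<open>D * x - D\<close> is \<open>D\<close> times the polynomial \<open>x - 1\<close> of the
      restriction to \<open>?N\<close>.\<close>
    ultimately show ?thesis
      using True charpoly_restriction_line[OF \<open>e \<in> carrier E\<close> \<open>e \<noteq> \<zero>\<^bsub>E\<^esub>\<close>, folded M_def] rank
      by (simp add: crosscut coloop deletion sum_diff1 right_diff_distrib)
  qed
qed

end
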